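(* For every integer $n\ge 1$, the free product $\mathbb{Z}^n*\mathbb{Z}$ embeds into the $n$-dimensional Thompson group $nV$, i.e. there is an injective group homomorphism $\mathbb{Z}^n*\mathbb{Z}\to nV$.
   Context: Let $I=[0,1)$. An $n$-dimensional rectangle is a subset of $I^n$ obtained by repeated dyadic divisions, i.e. a product $\prod_{d=1}^n I_d$ where each $I_d$ is of the form $[a/2^k,(a+1)/2^k)$ with integers $k\ge 0$, $0\le a<2^k$ (depending on $d$). An $n$-dimensional pattern is a finite set of pairwise disjoint $n$-dimensional rectangles whose union is $I^n$. A numbered pattern is a pattern together with a bijection to $\{0,\ldots,r-1\}$, where $r$ is the number of its rectangles. For numbered patterns $P=\{P_i\}_{0\le i\le r-1}$ and $Q=\{Q_i\}_{0\le i\le r-1}$ with the same number of rectangles, $v(P,Q):I^n\to I^n$ is the bijection taking each $P_i$ onto $Q_i$ affinely and preserving orientation (in each coordinate, an increasing affine map). The $n$-dimensional Thompson group $nV$ is the group, under composition, of all maps $v(P,Q)$. *)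

theory Defs
  imports Complex_Main "HOL-Algebra.Bij" "HOL-Algebra.Product_Groups"
begin

section \<open>Free product of two groups\<close>

text \<open>
  The elements of the free product are the reduced words: lists of nontrivial elements taken
  alternately from the two factors. The empty word is the identity.
\<close>

definition letters :: "('a, 'c) monoid_scheme \<Rightarrow> ('b, 'd) monoid_scheme \<Rightarrow> ('a + 'b) set" where
  "letters G H = Inl ` (carrier G - {\<one>\<^bsub>G\<^esub>}) \<union> Inr ` (carrier H - {\<one>\<^bsub>H\<^esub>})"

definition reduced_words ::
  "('a, 'c) monoid_scheme \<Rightarrow> ('b, 'd) monoid_scheme \<Rightarrow> ('a + 'b) list set" where
  "reduced_words G H =
     {w. set w \<subseteq> letters G H \<and> successively (\<lambda>s t. isl s \<noteq> isl t) w}"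

text \<open>Left multiplication of a reduced word by a single (nontrivial) letter.\<close>

fun letter_mult ::
  "('a, 'c) monoid_scheme \<Rightarrow> ('b, 'd) monoid_scheme \<Rightarrow> 'a + 'b \<Rightarrow> ('a + 'b) list \<Rightarrow> ('a + 'b) list"
  where
  "letter_mult G H (Inl a) (Inl b # w) =
     (if a \<otimes>\<^bsub>G\<^esub> b = \<one>\<^bsub>G\<^esub> then w else Inl (a \<otimes>\<^bsub>G\<^esub> b) # w)"
| "letter_mult G H (Inr a) (Inr b # w) =
     (if a \<otimes>\<^bsub>H\<^esub> b = \<one>\<^bsub>H\<^esub> then w else Inr (a \<otimes>\<^bsub>H\<^esub> b) # w)"
| "letter_mult G H s w = s # w"

definition free_product ::
  "('a, 'c) monoid_scheme \<Rightarrow> ('b, 'd) monoid_scheme \<Rightarrow> ('a + 'b) list monoid" where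
  "free_product G H =
     \<lparr>carrier = reduced_words G H,
      mult = foldr (letter_mult G H),
      one = []\<rparr>"

lemma reduced_words_Nil [simp]: "[] \<in> reduced_words G H"
  by (simp add: reduced_words_def)

lemma reduced_words_Cons:
  "s # w \<in> reduced_words G H \<longleftrightarrow>
     s \<in> letters G H \<and> w \<in> reduced_words G H \<and> (w = [] \<or> isl s \<noteq> isl (hd w))"
  by (auto simp: reduced_words_def successively_Cons)

lemma letter_mult_closed:
  assumes "group G" "group H" "s \<in> letters G H" "w \<in> reduced_words G H"
  shows "letter_mult G H s w \<in> reduced_words G H"
proof -
  interpret G: group G by fact
  interpret H: group H by fact
  show ?thesis
    using assms(3,4)
    by (cases "(G, H, s, w)" rule: letter_mult.cases)
       (auto simp: reduced_words_Cons letters_def)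
qed

lemma letter_mult_letter_mult:
  assumes "group G" "group H" "s \<in> letters G H" "t \<in> letters G H" "w \<in> reduced_words G H"
  shows "letter_mult G H s (letter_mult G H t w) =
           foldr (letter_mult G H) (letter_mult G H s [t]) w"
proof -
  interpret G: group G by fact
  interpret H: group H by fact
  have G2: "a \<otimes>\<^bsub>G\<^esub> (b \<otimes>\<^bsub>G\<^esub> c) = c"
    if "a \<otimes>\<^bsub>G\<^esub> b = \<one>\<^bsub>G\<^esub>" "a \<in> carrier G" "b \<in> carrier G" "c \<in> carrier G" for a b c
    using that by (simp flip: G.m_assoc)
  have H2: "a \<otimes>\<^bsub>H\<^esub> (b \<otimes>\<^bsub>H\<^esub> c) = c"
    if "a \<otimes>\<^bsub>H\<^esub> b = \<one>\<^bsub>H\<^esub>" "a \<in> carrier H" "b \<in> carrier H" "c \<in> carrier H" for a b c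
    using that by (simp flip: H.m_assoc)
  have G1: "a = c"
    if "a \<otimes>\<^bsub>G\<^esub> b = \<one>\<^bsub>G\<^esub>" "b \<otimes>\<^bsub>G\<^esub> c = \<one>\<^bsub>G\<^esub>"
      "a \<in> carrier G" "b \<in> carrier G" "c \<in> carrier G" for a b c
    using G2 [of a b c] that by simp
  have H1: "a = c"
    if "a \<otimes>\<^bsub>H\<^esub> b = \<one>\<^bsub>H\<^esub>" "b \<otimes>\<^bsub>H\<^esub> c = \<one>\<^bsub>H\<^esub>"
      "a \<in> carrier H" "b \<in> carrier H" "c \<in> carrier H" for a b c
    using H2 [of a b c] that by simp
  show ?thesis
  proof (cases w)
    case Nil
    then show ?thesis by (cases s; cases t) auto
  next
    case (Cons u v)
    show ?thesis
      using assms(3-5) Cons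
      by (cases s; cases t; cases u; cases v rule: list.exhaust; cases "hd v")
         (auto simp: reduced_words_Cons letters_def G2 H2 G.m_assoc H.m_assoc intro: G1 H1)
  qed
qed

lemma foldr_letter_mult_closed:
  assumes "group G" "group H" "set v \<subseteq> letters G H" "w \<in> reduced_words G H"
  shows "foldr (letter_mult G H) v w \<in> reduced_words G H"
  using assms(3) by (induction v) (auto intro: letter_mult_closed assms)

lemma foldr_letter_mult:
  assumes "group G" "group H" "s \<in> letters G H" "v \<in> reduced_words G H" "w \<in> reduced_words G H"
  shows "foldr (letter_mult G H) (letter_mult G H s v) w =
           letter_mult G H s (foldr (letter_mult G H) v w)"
proof (cases v)
  case Nil
  then show ?thesis by (cases s) auto
next
  case (Cons t v')
  have "letter_mult G H s v = letter_mult G H s [t] @ v'"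
    unfolding Cons by (cases s; cases t) auto
  moreover have "foldr (letter_mult G H) v' w \<in> reduced_words G H"
    using assms Cons by (intro foldr_letter_mult_closed) (auto simp: reduced_words_def)
  ultimately show ?thesis
    using letter_mult_letter_mult [OF assms(1,2,3)] assms(4) Cons
    by (simp add: reduced_words_Cons)
qed

lemma foldr_letter_mult_Nil:
  "v \<in> reduced_words G H \<Longrightarrow> foldr (letter_mult G H) v [] = v"
proof (induction v)
  case (Cons s v)
  then show ?case
    by (cases "(G, H, s, v)" rule: letter_mult.cases) (auto simp: reduced_words_Cons)
qed simp

lemma letters_inverse:
  assumes "group G" "group H" "s \<in> letters G H"
  shows "\<exists>t \<in> letters G H. letter_mult G H t [s] = []"
proof -
  interpret G: group G by fact
  interpret H: group H by fact
  show ?thesis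
  proof (cases s)
    case (Inl a)
    then have "Inl (inv\<^bsub>G\<^esub> a) \<in> letters G H" "letter_mult G H (Inl (inv\<^bsub>G\<^esub> a)) [s] = []"
      using assms(3) by (auto simp: letters_def G.inv_eq_1_iff)
    then show ?thesis by blast
  next
    case (Inr a)
    then have "Inr (inv\<^bsub>H\<^esub> a) \<in> letters G H" "letter_mult G H (Inr (inv\<^bsub>H\<^esub> a)) [s] = []"
      using assms(3) by (auto simp: letters_def H.inv_eq_1_iff)
    then show ?thesis by blast
  qed
qed

lemma group_free_product:
  assumes "group G" "group H"
  shows "group (free_product G H)"
proof (rule groupI)
  have sub: "set v \<subseteq> letters G H" if "v \<in> reduced_words G H" for v
    using that by (simp add: reduced_words_def)
  have assoc: "foldr (letter_mult G H) (foldr (letter_mult G H) u v) w =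
          foldr (letter_mult G H) u (foldr (letter_mult G H) v w)"
    if "set u \<subseteq> letters G H" "v \<in> reduced_words G H" "w \<in> reduced_words G H" for u v w
    using that(1)
  proof (induction u)
    case (Cons s u)
    then show ?case
      using foldr_letter_mult [OF assms, of s "foldr (letter_mult G H) u v" w] that
        foldr_letter_mult_closed [OF assms, of u v]
      by simp
  qed simp
  show "u \<otimes>\<^bsub>free_product G H\<^esub> v \<otimes>\<^bsub>free_product G H\<^esub> w =
        u \<otimes>\<^bsub>free_product G H\<^esub> (v \<otimes>\<^bsub>free_product G H\<^esub> w)"
    if "u \<in> carrier (free_product G H)" "v \<in> carrier (free_product G H)"
      "w \<in> carrier (free_product G H)" for u v w
    using that assoc sub by (simp add: free_product_def)
  show "u \<otimes>\<^bsub>free_product G H\<^esub> v \<in> carrier (free_product G H)"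
    if "u \<in> carrier (free_product G H)" "v \<in> carrier (free_product G H)" for u v
    using that foldr_letter_mult_closed [OF assms] sub by (simp add: free_product_def)
  have "\<exists>v \<in> reduced_words G H. foldr (letter_mult G H) v u = []"
    if "u \<in> reduced_words G H" for u
    using that
  proof (induction u)
    case (Cons s u)
    then have s: "s \<in> letters G H" and u: "u \<in> reduced_words G H"
      by (auto simp: reduced_words_Cons)
    obtain v where v: "v \<in> reduced_words G H" "foldr (letter_mult G H) v u = []"
      using Cons.IH u by blast
    obtain t where t: "t \<in> letters G H" "letter_mult G H t [s] = []"
      using letters_inverse [OF assms s] by blast
    have su: "letter_mult G H s u = s # u"
      using foldr_letter_mult_Nil [OF Cons.prems] foldr_letter_mult_Nil [OF u] by simp
    have ts: "letter_mult G H t (s # u) = u"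
      using letter_mult_letter_mult [OF assms t(1) s u] su t(2) by simp
    have t1: "[t] \<in> reduced_words G H"
      using t(1) by (simp add: reduced_words_def)
    have "foldr (letter_mult G H) (foldr (letter_mult G H) v [t]) (s # u) = []"
      using assoc [OF sub [OF v(1)] t1 Cons.prems] ts v(2) by simp
    moreover have "foldr (letter_mult G H) v [t] \<in> reduced_words G H"
      using foldr_letter_mult_closed [OF assms sub [OF v(1)] t1] .
    ultimately show ?case by blast
  qed (auto intro: bexI [of _ "[]"])
  then show "\<exists>v \<in> carrier (free_product G H). v \<otimes>\<^bsub>free_product G H\<^esub> u = \<one>\<^bsub>free_product G H\<^esub>"
    if "u \<in> carrier (free_product G H)" for u
    using that by (simp add: free_product_def)
qed (simp_all add: free_product_def)

section \<open>The \<open>n\<close>-dimensional Thompson group\<close>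

text \<open>Points of \<open>n\<close>-space are functions on \<open>{..<n}\<close>, extended by \<open>undefined\<close> outside.\<close>

definition unit_cube :: "nat \<Rightarrow> (nat \<Rightarrow> real) set" where
  "unit_cube n = ({..<n} \<rightarrow>\<^sub>E {0..<1})"

definition dyadic_interval :: "real set \<Rightarrow> bool" where
  "dyadic_interval J \<longleftrightarrow>
     (\<exists>k a :: nat. a < 2 ^ k \<and> J = {real a / 2 ^ k ..< (real a + 1) / 2 ^ k})"

definition rectangle :: "nat \<Rightarrow> (nat \<Rightarrow> real) set \<Rightarrow> bool" where
  "rectangle n R \<longleftrightarrow> (\<exists>J. (\<forall>d<n. dyadic_interval (J d)) \<and> R = (\<Pi>\<^sub>E d\<in>{..<n}. J d))"

definition is_pattern :: "nat \<Rightarrow> (nat \<Rightarrow> real) set set \<Rightarrow> bool" where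
  "is_pattern n \<P> \<longleftrightarrow>
     finite \<P> \<and> (\<forall>R\<in>\<P>. rectangle n R) \<and> pairwise disjnt \<P> \<and> \<Union>\<P> = unit_cube n"

definition numbered_pattern :: "nat \<Rightarrow> nat \<Rightarrow> (nat \<Rightarrow> (nat \<Rightarrow> real) set) \<Rightarrow> bool" where
  "numbered_pattern n r P \<longleftrightarrow> is_pattern n (P ` {..<r}) \<and> inj_on P {..<r}"

definition increasing_affine_onto ::
  "nat \<Rightarrow> (nat \<Rightarrow> real) set \<Rightarrow> (nat \<Rightarrow> real) set \<Rightarrow> ((nat \<Rightarrow> real) \<Rightarrow> nat \<Rightarrow> real) \<Rightarrow> bool" where
  "increasing_affine_onto n A B f \<longleftrightarrow>
     f ` A = B \<and>
     (\<exists>\<alpha> \<beta>. (\<forall>d<n. \<alpha> d > 0) \<and> (\<forall>x\<in>A. \<forall>d<n. f x d = \<alpha> d * x d + \<beta> d))"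

text \<open>\<open>is_pattern_map n r P Q f\<close> says that \<open>f\<close> is \<open>v(P,Q)\<close>.\<close>

definition is_pattern_map ::
  "nat \<Rightarrow> nat \<Rightarrow> (nat \<Rightarrow> (nat \<Rightarrow> real) set) \<Rightarrow> (nat \<Rightarrow> (nat \<Rightarrow> real) set) \<Rightarrow>
     ((nat \<Rightarrow> real) \<Rightarrow> nat \<Rightarrow> real) \<Rightarrow> bool" where
  "is_pattern_map n r P Q f \<longleftrightarrow>
     f \<in> Bij (unit_cube n) \<and> (\<forall>i<r. increasing_affine_onto n (P i) (Q i) f)"

definition thompson_group :: "nat \<Rightarrow> ((nat \<Rightarrow> real) \<Rightarrow> nat \<Rightarrow> real) monoid" where
  "thompson_group n =
     (BijGroup (unit_cube n))
       \<lparr>carrier := {f. \<exists>r P Q. numbered_pattern n r P \<and> numbered_pattern n r Q \<and>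
                         is_pattern_map n r P Q f}\<rparr>"

end

theory Submission
  imports Defs
begin

text \<open>
  Ping-pong. For disjoint dyadic boxes \<open>p ` X\<close> and \<open>q ` X\<close> there is a piecewise affine bijection
  that attracts to the first and repels from the second, so that all its nontrivial powers push the
  complement of both boxes into their union. In one variable, with the boxes \<open>[1/2, 3/4)\<close> and
  \<open>[3/4, 1)\<close>, this gives \<open>g\<close> whose nontrivial powers move \<open>[0, 1/2)\<close> off itself; letting \<open>\<int>\<^sup>n\<close>
  act by powers of \<open>g\<close> in each coordinate, every nontrivial element moves the cube \<open>[0, 1/2)\<^sup>n\<close>
  off itself. In \<open>n\<close> variables, with two small boxes inside \<open>[0, 1/2)\<^sup>n\<close>, it gives \<open>b\<close> whose
  nontrivial powers send everything outside these boxes into them. Hence \<open>\<int>\<^sup>n\<close> and \<open>b\<close> generate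
  their free product.
\<close>

section \<open>Homomorphisms out of a free product\<close>

text \<open>On reduced words this is the map that the universal property of the free product
  provides.\<close>

definition free_lift ::
  "('k, 'c) monoid_scheme \<Rightarrow> ('a \<Rightarrow> 'k) \<Rightarrow> ('b \<Rightarrow> 'k) \<Rightarrow> ('a + 'b) list \<Rightarrow> 'k" where
  "free_lift K \<phi> \<psi> w = foldr (\<lambda>s k. case_sum \<phi> \<psi> s \<otimes>\<^bsub>K\<^esub> k) w \<one>\<^bsub>K\<^esub>"

lemma free_lift_simps [simp]:
  "free_lift K \<phi> \<psi> [] = \<one>\<^bsub>K\<^esub>"
  "free_lift K \<phi> \<psi> (s # w) = case_sum \<phi> \<psi> s \<otimes>\<^bsub>K\<^esub> free_lift K \<phi> \<psi> w"
  by (simp_all add: free_lift_def)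

lemma carrier_free_product: "carrier (free_product G H) = reduced_words G H"
  by (simp add: free_product_def)

lemma reduced_words_letters: "w \<in> reduced_words G H \<Longrightarrow> set w \<subseteq> letters G H"
  by (simp add: reduced_words_def)

text \<open>A word evaluates to a product of images of letters, and the inverse of a letter is again
  a letter, so closure under products suffices. It serves twice: with \<open>S\<close> the carrier
  of \<open>K\<close>, and with \<open>S\<close> the cellwise bijections of the cube.\<close>

lemma free_lift_in:
  assumes "\<one>\<^bsub>K\<^esub> \<in> S" "\<And>k l. k \<in> S \<Longrightarrow> l \<in> S \<Longrightarrow> k \<otimes>\<^bsub>K\<^esub> l \<in> S"
    and "\<phi> ` carrier G \<subseteq> S" "\<psi> ` carrier H \<subseteq> S" "set w \<subseteq> letters G H"
  shows "free_lift K \<phi> \<psi> w \<in> S"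
  using assms(5)
proof (induction w)
  case (Cons s w)
  have "case_sum \<phi> \<psi> s \<in> S"
    using Cons.prems assms(3,4) by (auto simp: letters_def)
  then show ?case using Cons by (simp add: assms(2))
qed (simp add: assms)

context
  fixes G :: "('a, 'c) monoid_scheme" and H :: "('b, 'd) monoid_scheme"
    and K :: "('k, 'e) monoid_scheme" and \<phi> \<psi>
  assumes groups: "group G" "group H" "group K"
    and homs: "\<phi> \<in> hom G K" "\<psi> \<in> hom H K"
begin

interpretation G: group G by (rule groups)
interpretation H: group H by (rule groups)
interpretation K: group K by (rule groups)
interpretation \<phi>: group_hom G K \<phi> by unfold_locales (rule homs)
interpretation \<psi>: group_hom H K \<psi> by unfold_locales (rule homs)

lemma free_lift_closed: "set w \<subseteq> letters G H \<Longrightarrow> free_lift K \<phi> \<psi> w \<in> carrier K"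
  by (rule free_lift_in) auto

text \<open>Something happens only when \<open>s\<close> meets a letter of the same factor: merging
  is matched by multiplicativity of \<open>\<phi>\<close> or \<open>\<psi>\<close>, and cancellation
  by their sending the identity to the identity.\<close>

lemma free_lift_letter_mult:
  assumes "s \<in> letters G H" "set w \<subseteq> letters G H"
  shows "free_lift K \<phi> \<psi> (letter_mult G H s w) = case_sum \<phi> \<psi> s \<otimes>\<^bsub>K\<^esub> free_lift K \<phi> \<psi> w"
proof (cases "(G, H, s, w)" rule: letter_mult.cases)
  case (1 G' H' a b v)
  then have sw: "s = Inl a" "w = Inl b # v" by auto
  then have "a \<in> carrier G" "b \<in> carrier G" "free_lift K \<phi> \<psi> v \<in> carrier K"
    using assms free_lift_closed by (auto simp: letters_def)
  then have "\<phi> (a \<otimes>\<^bsub>G\<^esub> b) \<otimes>\<^bsub>K\<^esub> free_lift K \<phi> \<psi> v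
      = \<phi> a \<otimes>\<^bsub>K\<^esub> (\<phi> b \<otimes>\<^bsub>K\<^esub> free_lift K \<phi> \<psi> v)"
      "\<one>\<^bsub>K\<^esub> \<otimes>\<^bsub>K\<^esub> free_lift K \<phi> \<psi> v = free_lift K \<phi> \<psi> v"
    by (simp_all add: K.m_assoc)
  then show ?thesis unfolding sw by auto
next
  case (2 G' H' a b v)
  then have sw: "s = Inr a" "w = Inr b # v" by auto
  then have "a \<in> carrier H" "b \<in> carrier H" "free_lift K \<phi> \<psi> v \<in> carrier K"
    using assms free_lift_closed by (auto simp: letters_def)
  then have "\<psi> (a \<otimes>\<^bsub>H\<^esub> b) \<otimes>\<^bsub>K\<^esub> free_lift K \<phi> \<psi> v
      = \<psi> a \<otimes>\<^bsub>K\<^esub> (\<psi> b \<otimes>\<^bsub>K\<^esub> free_lift K \<phi> \<psi> v)"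
      "\<one>\<^bsub>K\<^esub> \<otimes>\<^bsub>K\<^esub> free_lift K \<phi> \<psi> v = free_lift K \<phi> \<psi> v"
    by (simp_all add: K.m_assoc)
  then show ?thesis unfolding sw by auto
qed auto

text \<open>The product of words folds \<open>letter_mult\<close> over the left word, so induction
  on that word reduces the claim to a single letter.\<close>

lemma free_lift_hom: "free_lift K \<phi> \<psi> \<in> hom (free_product G H) K"
proof (rule homI)
  fix u v
  assume "u \<in> carrier (free_product G H)" and v: "v \<in> carrier (free_product G H)"
  then have "set u \<subseteq> letters G H" "set v \<subseteq> letters G H"
    by (auto simp: carrier_free_product reduced_words_letters)
  then have "free_lift K \<phi> \<psi> (foldr (letter_mult G H) u v)
      = free_lift K \<phi> \<psi> u \<otimes>\<^bsub>K\<^esub> free_lift K \<phi> \<psi> v"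
  proof (induction u)
    case Nil
    then show ?case by (simp add: free_lift_closed)
  next
    case (Cons s u)
    have "foldr (letter_mult G H) u v \<in> reduced_words G H"
      using foldr_letter_mult_closed [OF groups(1,2)] Cons.prems v
      by (simp add: carrier_free_product)
    moreover have "case_sum \<phi> \<psi> s \<in> carrier K"
      using Cons.prems by (auto simp: letters_def)
    ultimately show ?case
      using Cons by (simp add: free_lift_letter_mult reduced_words_letters free_lift_closed K.m_assoc)
  qed
  then show "free_lift K \<phi> \<psi> (u \<otimes>\<^bsub>free_product G H\<^esub> v)
      = free_lift K \<phi> \<psi> u \<otimes>\<^bsub>K\<^esub> free_lift K \<phi> \<psi> v"
    by (simp add: free_product_def)
qed (simp add: carrier_free_product reduced_words_letters free_lift_closed)

end

section \<open>Ping-pong for groups of bijections\<close>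

lemma mult_BijGroup: "f \<in> Bij X \<Longrightarrow> g \<in> Bij X \<Longrightarrow> f \<otimes>\<^bsub>BijGroup X\<^esub> g = compose X f g"
  by (simp add: BijGroup_def)

lemma carrier_BijGroup: "carrier (BijGroup X) = Bij X"
  by (simp add: BijGroup_def)

lemma one_BijGroup: "\<one>\<^bsub>BijGroup X\<^esub> = (\<lambda>x\<in>X. x)"
  by (simp add: BijGroup_def)

text \<open>With a base point outside both sets, no conjugation of words is needed.\<close>

lemma ping_pong:
  assumes "group G" "group H" "\<phi> \<in> hom G (BijGroup X)" "\<psi> \<in> hom H (BijGroup X)"
    and x: "x \<in> X" "x \<notin> A" "x \<notin> B"
    and "A \<subseteq> X" "B \<subseteq> X"
    and A: "\<And>g y. g \<in> carrier G \<Longrightarrow> g \<noteq> \<one>\<^bsub>G\<^esub> \<Longrightarrow> y \<in> insert x B \<Longrightarrow> \<phi> g y \<in> A"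
    and B: "\<And>h y. h \<in> carrier H \<Longrightarrow> h \<noteq> \<one>\<^bsub>H\<^esub> \<Longrightarrow> y \<in> insert x A \<Longrightarrow> \<psi> h y \<in> B"
  shows "inj_on (free_lift (BijGroup X) \<phi> \<psi>) (carrier (free_product G H))"
proof -
  let ?f = "free_lift (BijGroup X) \<phi> \<psi>"
  have hom: "?f \<in> hom (free_product G H) (BijGroup X)"
    using assms group_BijGroup by (intro free_lift_hom)
  \<comment> \<open>The leftmost letter acts last, so the position of the image of \<open>x\<close>
    reveals the factor of that letter.\<close>
  have main: "w \<noteq> [] \<longrightarrow> (if isl (hd w) then ?f w x \<in> A else ?f w x \<in> B)"
    if "w \<in> reduced_words G H" for w
    using that
  proof (induction w)
    case (Cons s w)
    then have s: "s \<in> letters G H" and w: "w \<in> reduced_words G H"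
      and alt: "w = [] \<or> isl s \<noteq> isl (hd w)"
      by (auto simp: reduced_words_Cons)
    have "?f w \<in> Bij X"
      using hom w by (auto simp: hom_def carrier_free_product carrier_BijGroup)
    moreover have "case_sum \<phi> \<psi> s \<in> Bij X"
      using s assms(3,4) by (auto simp: letters_def hom_def carrier_BijGroup)
    ultimately have eq: "?f (s # w) x = case_sum \<phi> \<psi> s (?f w x)"
      using x by (simp add: mult_BijGroup compose_eq)
    have start: "?f w x = x" if "w = []"
      using that x by (simp add: one_BijGroup)
    show ?case
    proof (cases s)
      case (Inl g)
      then have "?f w x \<in> insert x B"
        using alt start Cons.IH w by (cases "w = []") auto
      then show ?thesis using A eq Inl s by (auto simp: letters_def)
    next
      case (Inr h)
      then have "?f w x \<in> insert x A"
        using alt start Cons.IH w by (cases "w = []") auto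
      then show ?thesis using B eq Inr s by (auto simp: letters_def)
    qed
  qed simp
  \<comment> \<open>A nonempty word moves \<open>x\<close> into \<open>A\<close> or
    \<open>B\<close>, but \<open>x\<close> lies in neither, so such a word does not act as the
    identity.\<close>
  have "w = []" if "w \<in> reduced_words G H" "?f w = \<one>\<^bsub>BijGroup X\<^esub>" for w
    using main [OF that(1)] that(2) x by (auto simp: one_BijGroup split: if_splits)
  moreover have "\<one>\<^bsub>free_product G H\<^esub> = []"
    by (simp add: free_product_def)
  ultimately show ?thesis
    using inj_on_one_iff' [OF hom] group_free_product assms(1,2) group_BijGroup
    by (metis carrier_free_product)
qed

section \<open>Bijections with large wandering sets\<close>

text \<open>
  Outside \<open>q ` X\<close> the map \<open>exchange X p q\<close> is \<open>p\<close>, and outside \<open>p ` X\<close> its inverse is \<open>q\<close>; what is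
  left over, \<open>q ` p ` X\<close>, is sent to \<open>p ` q ` X\<close>.
\<close>

definition exchange :: "'a set \<Rightarrow> ('a \<Rightarrow> 'a) \<Rightarrow> ('a \<Rightarrow> 'a) \<Rightarrow> 'a \<Rightarrow> 'a" where
  "exchange X p q =
     (\<lambda>x\<in>X. if x \<in> q ` X
        then let y = inv_into X q x in if y \<in> p ` X then p (q (inv_into X p y)) else y
        else p x)"

context
  fixes X :: "'a set" and p q :: "'a \<Rightarrow> 'a"
  assumes maps: "p ` X \<subseteq> X" "q ` X \<subseteq> X" and inj: "inj_on p X" "inj_on q X"
begin

lemma exchange_outside: "x \<in> X \<Longrightarrow> x \<notin> q ` X \<Longrightarrow> exchange X p q x = p x"
  by (simp add: exchange_def)

lemma exchange_inner: "x \<in> X \<Longrightarrow> exchange X p q (q (p x)) = p (q x)"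
  using maps inj by (auto simp: exchange_def Let_def image_subset_iff)

lemma exchange_middle: "x \<in> X \<Longrightarrow> x \<notin> p ` X \<Longrightarrow> exchange X p q (q x) = x"
  using maps inj by (auto simp: exchange_def Let_def image_subset_iff)

lemma exchange_cases:
  assumes "x \<in> X"
  obtains "x \<notin> q ` X" | y where "y \<in> X" "y \<notin> p ` X" "x = q y" | y where "y \<in> X" "x = q (p y)"
  using assms by blast

lemma exchange_closed: "x \<in> X \<Longrightarrow> exchange X p q x \<in> X"
  by (cases x rule: exchange_cases)
    (use maps in \<open>auto simp: exchange_outside exchange_inner exchange_middle image_subset_iff\<close>)

end

text \<open>\<open>exchange X q p\<close> takes its three pieces onto the three pieces on which
  \<open>exchange X p q\<close> is given by a single formula, and there the formulas undo one
  another.\<close>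

lemma exchange_inverse:
  assumes "p ` X \<subseteq> X" "q ` X \<subseteq> X" "inj_on p X" "inj_on q X" "x \<in> X"
  shows "exchange X p q (exchange X q p x) = x"
proof -
  note * = exchange_outside exchange_inner exchange_middle
  show ?thesis
    using exchange_cases [OF assms(2,1,4,3,5)]
    by cases (use assms in \<open>auto simp: * image_subset_iff\<close>)
qed

lemma exchange_Bij:
  assumes "p ` X \<subseteq> X" "q ` X \<subseteq> X" "inj_on p X" "inj_on q X"
  shows "exchange X p q \<in> Bij X"
proof -
  have "bij_betw (exchange X p q) X X"
    by (rule bij_betw_byWitness [where f' = "exchange X q p"])
      (use assms exchange_inverse exchange_closed in auto)
  then show ?thesis by (simp add: Bij_def exchange_def)
qed

text \<open>This turns negative powers into positive powers with \<open>p\<close> and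
  \<open>q\<close> swapped, so that statements about natural powers extend to integer ones.\<close>

lemma inv_exchange:
  assumes "p ` X \<subseteq> X" "q ` X \<subseteq> X" "inj_on p X" "inj_on q X"
  shows "inv\<^bsub>BijGroup X\<^esub> exchange X p q = exchange X q p"
proof (rule group.inv_equality [OF group_BijGroup])
  show "exchange X q p \<otimes>\<^bsub>BijGroup X\<^esub> exchange X p q = \<one>\<^bsub>BijGroup X\<^esub>"
    using assms
    by (auto simp: mult_BijGroup exchange_Bij one_BijGroup compose_def exchange_inverse intro: restrict_ext)
qed (use assms exchange_Bij in \<open>auto simp: carrier_BijGroup\<close>)

text \<open>A point outside the image of \<open>q\<close> enters the image of \<open>p\<close> in
  one step. This image is disjoint from that of \<open>q\<close>, so the map is still
  \<open>p\<close> there and the orbit never leaves it.\<close>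

lemma exchange_nat_pow_wandering:
  assumes "p ` X \<subseteq> X" "q ` X \<subseteq> X" "inj_on p X" "inj_on q X" "p ` X \<inter> q ` X = {}"
    and x: "x \<in> X" "x \<notin> q ` X"
  shows "(exchange X p q [^]\<^bsub>BijGroup X\<^esub> Suc m) x \<in> p ` X"
proof -
  interpret group "BijGroup X" by (rule group_BijGroup)
  have T: "exchange X p q \<in> carrier (BijGroup X)"
    using assms exchange_Bij by (auto simp: carrier_BijGroup)
  show ?thesis
  proof (induction m)
    case 0
    show ?case using T x by (simp add: exchange_outside [OF assms(1-4)])
  next
    case (Suc m)
    let ?y = "(exchange X p q [^]\<^bsub>BijGroup X\<^esub> Suc m) x"
    \<comment> \<open>The new factor goes on the left, so that it acts last, on a point already in
      the image of \<open>p\<close>.\<close>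
    have "exchange X p q [^]\<^bsub>BijGroup X\<^esub> Suc (Suc m)
        = exchange X p q \<otimes>\<^bsub>BijGroup X\<^esub> (exchange X p q [^]\<^bsub>BijGroup X\<^esub> Suc m)"
      using T nat_pow_Suc2 by blast
    also have "\<dots> = compose X (exchange X p q) (exchange X p q [^]\<^bsub>BijGroup X\<^esub> Suc m)"
      using T nat_pow_closed [OF T, of "Suc m"] by (simp only: carrier_BijGroup mult_BijGroup)
    finally have "(exchange X p q [^]\<^bsub>BijGroup X\<^esub> Suc (Suc m)) x = exchange X p q ?y"
      using x by (simp only: compose_eq)
    moreover have "?y \<in> X" "?y \<notin> q ` X"
      using Suc assms by blast+
    ultimately show ?case
      using exchange_outside [OF assms(1-4)] by (metis imageI)
  qed
qed

text \<open>Positive powers end in the image of \<open>p\<close>, negative ones in the image of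
  \<open>q\<close>.\<close>

lemma exchange_int_pow_wandering:
  fixes z :: int
  assumes pq: "p ` X \<subseteq> X" "q ` X \<subseteq> X" "inj_on p X" "inj_on q X" "p ` X \<inter> q ` X = {}"
    and x: "x \<in> X" "x \<notin> p ` X" "x \<notin> q ` X" and "z \<noteq> 0"
  shows "(exchange X p q [^]\<^bsub>BijGroup X\<^esub> z) x \<in> p ` X \<union> q ` X"
proof -
  interpret group "BijGroup X" by (rule group_BijGroup)
  have T: "exchange X p q \<in> carrier (BijGroup X)"
    using assms exchange_Bij by (auto simp: carrier_BijGroup)
  show ?thesis
  proof (cases "z > 0")
    case True
    then obtain m where z: "z = int (Suc m)"
      using gr0_conv_Suc pos_int_cases by metis
    show ?thesis
      unfolding z int_pow_int using exchange_nat_pow_wandering [OF pq x(1,3)] by blast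
  next
    case False
    then obtain m where z: "z = - int (Suc m)"
      using assms(9) by (metis linorder_neqE_linordered_idom neg_int_cases gr0_conv_Suc)
    have "exchange X p q [^]\<^bsub>BijGroup X\<^esub> z = exchange X q p [^]\<^bsub>BijGroup X\<^esub> Suc m"
      unfolding z using T by (simp only: int_pow_neg int_pow_int nat_pow_inv flip: inv_exchange [OF pq(1-4)])
    then show ?thesis
      using exchange_nat_pow_wandering [OF pq(2,1,4,3) _ x(1,2)] pq(5) by auto
  qed
qed

section \<open>Maps sending small cells to cells\<close>

text \<open>
  \<open>C K\<close> stands for the parametrisations \<open>X \<rightarrow> X\<close> of the cells of level at least \<open>K\<close>, so that
  \<open>cellwise f\<close> says that \<open>f\<close> carries every sufficiently small cell canonically onto a cell.
\<close>

locale cell_system =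
  fixes X :: "'a set" and C :: "nat \<Rightarrow> ('a \<Rightarrow> 'a) set"
  assumes maps: "e \<in> C 0 \<Longrightarrow> e ` X \<subseteq> X"
    and inj: "e \<in> C 0 \<Longrightarrow> inj_on e X"
    and level_mono: "K \<le> L \<Longrightarrow> C L \<subseteq> C K"
    and comp: "e \<in> C 0 \<Longrightarrow> f \<in> C L \<Longrightarrow> e \<circ> f \<in> C L"
    and factor: "e \<in> C (K + L) \<Longrightarrow> \<exists>f\<in>C K. \<exists>g\<in>C L. e = f \<circ> g"
    and nested: "p \<in> C 0 \<Longrightarrow>
      \<exists>M. \<forall>K. \<forall>e\<in>C (M + K). e ` X \<inter> p ` X = {} \<or> (\<exists>f\<in>C K. e = p \<circ> f)"
begin

definition cellwise :: "('a \<Rightarrow> 'a) \<Rightarrow> bool" where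
  "cellwise f \<longleftrightarrow> (\<exists>K. \<forall>e\<in>C K. \<exists>e'\<in>C 0. \<forall>x\<in>X. f (e x) = e' x)"

lemma level_0: "e \<in> C K \<Longrightarrow> e \<in> C 0"
  using level_mono [of 0 K] by auto

lemma cell_closed: "e \<in> C K \<Longrightarrow> x \<in> X \<Longrightarrow> e x \<in> X"
  using maps [OF level_0] by auto

lemma cellwise_id: "cellwise (\<lambda>x\<in>X. x)"
  unfolding cellwise_def by (intro exI [of _ 0]) (auto intro: cell_closed)

text \<open>A cell of level \<open>K + L\<close> is \<open>a \<circ> b\<close> with \<open>a\<close>
  of level \<open>K\<close> and \<open>b\<close> of level \<open>L\<close>. The map \<open>g\<close>
  turns \<open>a\<close> into a cell \<open>c\<close>, and \<open>c \<circ> b\<close> still has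
  level \<open>L\<close>, so \<open>f\<close> can be applied to it.\<close>

lemma cellwise_compose:
  assumes "cellwise f" "cellwise g"
  shows "cellwise (compose X f g)"
proof -
  obtain L where L: "\<And>e. e \<in> C L \<Longrightarrow> \<exists>e'\<in>C 0. \<forall>x\<in>X. f (e x) = e' x"
    using assms(1) by (auto simp: cellwise_def)
  obtain K where K: "\<And>e. e \<in> C K \<Longrightarrow> \<exists>e'\<in>C 0. \<forall>x\<in>X. g (e x) = e' x"
    using assms(2) by (auto simp: cellwise_def)
  have "\<exists>e'\<in>C 0. \<forall>x\<in>X. compose X f g (e x) = e' x" if "e \<in> C (K + L)" for e
  proof -
    obtain a b where ab: "a \<in> C K" "b \<in> C L" "e = a \<circ> b"
      using factor \<open>e \<in> C (K + L)\<close> by blast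
    obtain c where c: "c \<in> C 0" "\<And>x. x \<in> X \<Longrightarrow> g (a x) = c x"
      using K ab by blast
    obtain d where "d \<in> C 0" "\<And>x. x \<in> X \<Longrightarrow> f (c (b x)) = d x"
      using L comp [OF c(1) ab(2)] by fastforce
    then show ?thesis
      using ab c by (auto simp: compose_def cell_closed intro!: bexI [of _ d])
  qed
  then show ?thesis unfolding cellwise_def by blast
qed

text \<open>Small cells do not straddle the pieces of the map. A cell of level \<open>M + N\<close>
  misses the image of \<open>q\<close>, or it is \<open>q \<circ> f\<close> with \<open>f\<close> of
  level \<open>N\<close>; in turn \<open>f\<close> misses the image of \<open>p\<close> or factors
  through \<open>p\<close>.\<close>

lemma cellwise_exchange:
  assumes p: "p \<in> C 0" and q: "q \<in> C 0"
  shows "cellwise (exchange X p q)"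
proof -
  note pq = maps [OF p] maps [OF q] inj [OF p] inj [OF q]
  obtain M where M: "\<And>K e. e \<in> C (M + K) \<Longrightarrow> e ` X \<inter> q ` X = {} \<or> (\<exists>f\<in>C K. e = q \<circ> f)"
    using nested [OF q] by (elim exE) (rule that, blast)
  obtain N where N: "\<And>K e. e \<in> C (N + K) \<Longrightarrow> e ` X \<inter> p ` X = {} \<or> (\<exists>f\<in>C K. e = p \<circ> f)"
    using nested [OF p] by (elim exE) (rule that, blast)
  have "\<exists>e'\<in>C 0. \<forall>x\<in>X. exchange X p q (e x) = e' x" if e: "e \<in> C (M + N)" for e
  proof (cases "e ` X \<inter> q ` X = {}")
    case True
    then have "exchange X p q (e x) = (p \<circ> e) x" if "x \<in> X" for x
      using exchange_outside [OF pq cell_closed [OF e that]] that by auto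
    then show ?thesis using comp p level_0 [OF e] by blast
  next
    case False
    then obtain f where f: "f \<in> C N" "e = q \<circ> f" using M e by blast
    show ?thesis
    proof (cases "f ` X \<inter> p ` X = {}")
      case True
      then have "exchange X p q (e x) = f x" if "x \<in> X" for x
        using exchange_middle [OF pq cell_closed [OF f(1) that]] f(2) that by auto
      then show ?thesis using level_0 f by blast
    next
      case False
      then obtain g where g: "g \<in> C 0" "f = p \<circ> g" using N [of f 0] f by auto
      then have "exchange X p q (e x) = (p \<circ> (q \<circ> g)) x" if "x \<in> X" for x
        using exchange_inner [OF pq cell_closed [OF g(1) that]] f(2) g(2) by simp
      then show ?thesis using comp p q g by blast
    qed
  qed
  then show ?thesis unfolding cellwise_def by blast
qed

lemma cellwise_exchange_int_pow:
  fixes z :: int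
  assumes p: "p \<in> C 0" and q: "q \<in> C 0"
  shows "cellwise (exchange X p q [^]\<^bsub>BijGroup X\<^esub> z)"
proof -
  interpret group "BijGroup X" by (rule group_BijGroup)
  \<comment> \<open>\<open>p\<close> and \<open>q\<close> are quantified anew, because negative
    powers need the same claim with the two swapped.\<close>
  have nat: "cellwise (exchange X p q [^]\<^bsub>BijGroup X\<^esub> m)"
    if p: "p \<in> C 0" and q: "q \<in> C 0" for p q and m :: nat
  proof (induction m)
    case (Suc m)
    have T: "exchange X p q \<in> Bij X"
      by (intro exchange_Bij maps inj p q)
    then have "exchange X p q [^]\<^bsub>BijGroup X\<^esub> m \<in> Bij X"
      using nat_pow_closed by (metis carrier_BijGroup)
    with T Suc show ?case
      by (simp add: mult_BijGroup cellwise_compose cellwise_exchange p q)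
  qed (simp only: nat_pow_0 one_BijGroup cellwise_id)
  have T: "exchange X p q \<in> carrier (BijGroup X)"
    unfolding carrier_BijGroup by (intro exchange_Bij maps inj p q)
  have "exchange X p q [^]\<^bsub>BijGroup X\<^esub> (- int m) = exchange X q p [^]\<^bsub>BijGroup X\<^esub> m" for m
    using T inv_exchange [OF maps maps inj inj, OF p q p q]
    by (simp add: int_pow_neg int_pow_int flip: nat_pow_inv)
  then show ?thesis
    using nat [OF p q] nat [OF q p] by (cases z rule: int_cases2) (simp_all add: int_pow_int)
qed

end

section \<open>Dyadic intervals and boxes\<close>

text \<open>Dyadic intervals are represented by their increasing affine parametrisations by
  \<open>[0, 1)\<close>, so that nesting of intervals becomes composition of maps.\<close>

definition dyad :: "nat \<Rightarrow> nat \<Rightarrow> real \<Rightarrow> real" where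
  "dyad k a t = (t + real a) / 2 ^ k"

definition dyads :: "nat \<Rightarrow> (real \<Rightarrow> real) set" where
  "dyads K = {dyad k a | k a. K \<le> k \<and> a < 2 ^ k}"

lemma dyadsI: "K \<le> k \<Longrightarrow> a < 2 ^ k \<Longrightarrow> dyad k a \<in> dyads K"
  by (auto simp: dyads_def)

text \<open>For \<open>b < 2 ^ l\<close> the \<open>l\<close> binary digits of \<open>b\<close> are
  appended to those of \<open>a\<close>. Division by \<open>2 ^ l\<close> with remainder separates
  them again, which gives \<open>dyad_split\<close>.\<close>

lemma dyad_comp: "dyad k a \<circ> dyad l b = dyad (k + l) (a * 2 ^ l + b)"
  by (auto simp: dyad_def field_simps power_add)

lemma dyad_split: "dyad (k + l) c = dyad k (c div 2 ^ l) \<circ> dyad l (c mod 2 ^ l)"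
  by (simp only: dyad_comp div_mult_mod_eq)

text \<open>Clearing the denominator leaves \<open>s + a = t + b\<close>, where integer and
  fractional parts must agree. In particular distinct dyadic intervals of the same level are
  disjoint.\<close>

lemma dyad_eq_iff:
  assumes "0 \<le> s" "s < 1" "0 \<le> t" "t < 1"
  shows "dyad k a s = dyad k b t \<longleftrightarrow> a = b \<and> s = t"
proof
  assume "dyad k a s = dyad k b t"
  then have eq: "s + real a = t + real b" by (simp add: dyad_def)
  then have "real a < real (Suc b)" "real b < real (Suc a)"
    using assms by simp_all
  then have "a = b" by (simp only: of_nat_less_iff)
  with eq show "a = b \<and> s = t" by simp
qed simp

lemma dyad_unit:
  assumes "a < 2 ^ k" "t \<in> {0..<1}"
  shows "dyad k a t \<in> {0..<1}"
proof -
  have "real a + 1 \<le> 2 ^ k"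
    using assms(1) by (metis Suc_leI of_nat_Suc of_nat_le_iff of_nat_numeral of_nat_power add.commute)
  then show ?thesis using assms(2) by (auto simp: dyad_def)
qed

lemma dyad_image: "dyad k a ` {0..<1} = {real a / 2 ^ k ..< (real a + 1) / 2 ^ k}"
proof (intro Set.set_eqI iffI)
  fix y
  assume "y \<in> {real a / 2 ^ k ..< (real a + 1) / 2 ^ k}"
  then have "y = dyad k a (y * 2 ^ k - real a)" "y * 2 ^ k - real a \<in> {0..<1}"
    by (auto simp: dyad_def field_simps)
  then show "y \<in> dyad k a ` {0..<1}" by blast
qed (auto simp: dyad_def divide_right_mono divide_strict_right_mono)

interpretation unit_interval: cell_system "{0..<1}" dyads
proof
  fix e :: "real \<Rightarrow> real"
  assume "e \<in> dyads 0"
  then show "e ` {0..<1} \<subseteq> {0..<1}" "inj_on e {0..<1}"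
    using dyad_unit by (auto simp: dyads_def inj_on_def dyad_eq_iff)
next
  fix K L :: nat
  assume "K \<le> L"
  then show "dyads L \<subseteq> dyads K" by (auto simp: dyads_def) (metis le_trans)
next
  fix e f :: "real \<Rightarrow> real" and L
  assume "e \<in> dyads 0" "f \<in> dyads L"
  then obtain k a l b where *: "e = dyad k a" "a < 2 ^ k" "f = dyad l b" "b < 2 ^ l" "L \<le> l"
    by (auto simp: dyads_def)
  \<comment> \<open>Because \<open>b < 2 ^ l\<close>, the composite index
    \<open>a * 2 ^ l + b\<close> stays below \<open>Suc a * 2 ^ l\<close>.\<close>
  then have "Suc a * 2 ^ l \<le> 2 ^ k * 2 ^ l"
    by (intro mult_le_mono1) auto
  with * have "a * 2 ^ l + b < 2 ^ (k + l)"
    by (simp add: power_add)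
  with * show "e \<circ> f \<in> dyads L"
    unfolding dyads_def by (force simp: dyad_comp)
next
  fix e :: "real \<Rightarrow> real" and K L
  assume "e \<in> dyads (K + L)"
  \<comment> \<open>The outer factor gets level exactly \<open>K\<close>; all the remaining level
    \<open>l\<close>, which is at least \<open>L\<close>, goes to the inner one.\<close>
  then obtain l c where "e = dyad (K + l) c" "c < 2 ^ (K + l)" "L \<le> l"
    by (auto simp: dyads_def le_iff_add add.assoc)
  moreover from this have "c div 2 ^ l < 2 ^ K"
    by (simp add: less_mult_imp_div_less power_add)
  ultimately show "\<exists>f\<in>dyads K. \<exists>g\<in>dyads L. e = f \<circ> g"
    by (intro bexI [of _ "dyad K (c div 2 ^ l)"] bexI [of _ "dyad l (c mod 2 ^ l)"])
      (simp_all add: dyad_split dyadsI)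
next
  fix p :: "real \<Rightarrow> real"
  assume "p \<in> dyads 0"
  \<comment> \<open>The level \<open>m\<close> of \<open>p\<close> serves as \<open>M\<close>: an
    interval of level at least \<open>m\<close> lies in the interval of level \<open>m\<close> given
    by its leading digits, and this either is the image of \<open>p\<close> or is disjoint from
    it.\<close>
  then obtain m c where p: "p = dyad m c" by (auto simp: dyads_def)
  have "e ` {0..<1} \<inter> p ` {0..<1} = {} \<or> (\<exists>f\<in>dyads K. e = p \<circ> f)"
    if "e \<in> dyads (m + K)" for K e
  proof -
    obtain l a where l: "e = dyad (m + l) a" "K \<le> l"
      using \<open>e \<in> dyads (m + K)\<close> by (auto simp: dyads_def le_iff_add add.assoc)
    then have e: "e = dyad m (a div 2 ^ l) \<circ> dyad l (a mod 2 ^ l)"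
      by (simp only: dyad_split)
    have "dyad l (a mod 2 ^ l) \<in> dyads K"
      using l by (simp add: dyadsI)
    moreover have "e ` {0..<1} \<inter> p ` {0..<1} = {}" if "a div 2 ^ l \<noteq> c"
    proof -
      have "dyad l (a mod 2 ^ l) t \<in> {0..<1}" if "t \<in> {0..<1}" for t
        using that by (intro dyad_unit) auto
      then show ?thesis
        using that by (auto simp: e p dyad_eq_iff)
    qed
    ultimately show ?thesis using e p by blast
  qed
  then show "\<exists>M. \<forall>K. \<forall>e\<in>dyads (M + K).
      e ` {0..<1} \<inter> p ` {0..<1} = {} \<or> (\<exists>f\<in>dyads K. e = p \<circ> f)"
    by blast
qed

section \<open>Boxes as products of dyadic intervals\<close>

definition box :: "nat \<Rightarrow> (nat \<Rightarrow> real \<Rightarrow> real) \<Rightarrow> (nat \<Rightarrow> real) \<Rightarrow> nat \<Rightarrow> real" where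
  "box n u x = (\<lambda>d\<in>{..<n}. u d (x d))"

text \<open>As with the rectangles of a pattern, the sides may have different levels;
  \<open>K\<close> is a common lower bound for them.\<close>

definition boxes :: "nat \<Rightarrow> nat \<Rightarrow> ((nat \<Rightarrow> real) \<Rightarrow> nat \<Rightarrow> real) set" where
  "boxes n K = {box n u | u. \<forall>d<n. u d \<in> dyads K}"

lemma box_apply [simp]: "d < n \<Longrightarrow> box n u x d = u d (x d)"
  by (simp add: box_def)

lemma box_comp: "box n u \<circ> box n v = box n (\<lambda>d. u d \<circ> v d)"
  by (auto simp: box_def fun_eq_iff)

lemma box_cong: "(\<And>d. d < n \<Longrightarrow> u d = v d) \<Longrightarrow> box n u = box n v"
  by (auto simp: box_def fun_eq_iff)

lemma boxesI: "(\<And>d. d < n \<Longrightarrow> u d \<in> dyads K) \<Longrightarrow> box n u \<in> boxes n K"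
  by (auto simp: boxes_def)

lemma unit_cube_apply: "x \<in> unit_cube n \<Longrightarrow> d < n \<Longrightarrow> x d \<in> {0..<1}"
  by (auto simp: unit_cube_def PiE_iff)

lemma unit_cube_eqI:
  "x \<in> unit_cube n \<Longrightarrow> y \<in> unit_cube n \<Longrightarrow> (\<And>d. d < n \<Longrightarrow> x d = y d) \<Longrightarrow> x = y"
  unfolding unit_cube_def by (rule PiE_ext) auto

lemma box_unit_cube: "(\<And>d. d < n \<Longrightarrow> u d (x d) \<in> {0..<1}) \<Longrightarrow> box n u x \<in> unit_cube n"
  by (auto simp: unit_cube_def box_def)

text \<open>Everything is inherited coordinatewise from the unit interval. For nesting, boxes that
  meet do so in every coordinate, hence each side of a small box factors through the matching side
  of \<open>p\<close>.\<close>

lemma cell_system_unit_cube: "cell_system (unit_cube n) (boxes n)"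
proof
  fix e
  assume "e \<in> boxes n 0"
  then obtain u where u: "e = box n u" "\<And>d. d < n \<Longrightarrow> u d \<in> dyads 0"
    by (auto simp: boxes_def)
  then show "e ` unit_cube n \<subseteq> unit_cube n"
    using unit_interval.cell_closed unit_cube_apply by (blast intro: box_unit_cube)
  have "x d = y d" if "x \<in> unit_cube n" "y \<in> unit_cube n" "e x = e y" "d < n" for x y d
  proof -
    have "u d (x d) = u d (y d)"
      using that u(1) box_apply by metis
    then show ?thesis
      using unit_interval.inj [OF u(2)] unit_cube_apply that by (meson inj_onD)
  qed
  then show "inj_on e (unit_cube n)"
    by (auto intro!: inj_onI unit_cube_eqI)
next
  fix K L :: nat
  assume "K \<le> L"
  then show "boxes n L \<subseteq> boxes n K"
    using subsetD [OF unit_interval.level_mono] unfolding boxes_def by blast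
next
  fix e f L
  assume "e \<in> boxes n 0" "f \<in> boxes n L"
  then show "e \<circ> f \<in> boxes n L"
    by (auto simp: boxes_def box_comp intro!: boxesI [unfolded boxes_def] unit_interval.comp)
next
  fix e K L
  assume "e \<in> boxes n (K + L)"
  then obtain u where u: "e = box n u" "\<forall>d<n. u d \<in> dyads (K + L)"
    by (auto simp: boxes_def)
  have "\<forall>d. \<exists>f g. d < n \<longrightarrow> f \<in> dyads K \<and> g \<in> dyads L \<and> u d = f \<circ> g"
    using unit_interval.factor u(2) by blast
  then obtain f g where fg: "\<And>d. d < n \<Longrightarrow> f d \<in> dyads K \<and> g d \<in> dyads L \<and> u d = f d \<circ> g d"
    unfolding choice_iff by blast
  have "e = box n f \<circ> box n g"
    unfolding u(1) box_comp using fg by (intro box_cong) blast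
  then show "\<exists>f\<in>boxes n K. \<exists>g\<in>boxes n L. e = f \<circ> g"
    using fg by (blast intro: boxesI)
next
  fix p
  assume "p \<in> boxes n 0"
  then obtain w where w: "p = box n w" "\<forall>d<n. w d \<in> dyads 0"
    by (auto simp: boxes_def)
  have "\<forall>d. \<exists>m. d < n \<longrightarrow> (\<forall>K. \<forall>e\<in>dyads (m + K).
      e ` {0..<1} \<inter> w d ` {0..<1} = {} \<or> (\<exists>f\<in>dyads K. e = w d \<circ> f))"
    using unit_interval.nested w(2) by simp
  then obtain m where m: "\<forall>d. d < n \<longrightarrow> (\<forall>K. \<forall>e\<in>dyads (m d + K).
      e ` {0..<1} \<inter> w d ` {0..<1} = {} \<or> (\<exists>f\<in>dyads K. e = w d \<circ> f))"
    by (rule choice [THEN exE])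
  \<comment> \<open>The sum is merely a convenient upper bound for all the thresholds
    \<open>m d\<close>.\<close>
  define M where "M = (\<Sum>d<n. m d)"
  have "e ` unit_cube n \<inter> p ` unit_cube n = {} \<or> (\<exists>f\<in>boxes n K. e = p \<circ> f)"
    if e: "e \<in> boxes n (M + K)" for K e
  proof (cases "e ` unit_cube n \<inter> p ` unit_cube n = {}")
    case False
    then obtain x y where xy: "x \<in> unit_cube n" "y \<in> unit_cube n" "e x = p y" by auto
    obtain u where u: "e = box n u" "\<And>d. d < n \<Longrightarrow> u d \<in> dyads (M + K)"
      using e by (auto simp: boxes_def)
    have "\<exists>f\<in>dyads K. u d = w d \<circ> f" if d: "d < n" for d
    proof -
      have "m d \<le> M" unfolding M_def using d by (intro member_le_sum) auto
      then have "u d \<in> dyads (m d + K)"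
        using u(2) [OF d] unit_interval.level_mono [of "m d + K" "M + K"] by auto
      moreover have "u d (x d) = w d (y d)"
        using xy(3) u(1) w(1) d box_apply by metis
      then have "u d ` {0..<1} \<inter> w d ` {0..<1} \<noteq> {}"
        using unit_cube_apply [OF xy(1) d] unit_cube_apply [OF xy(2) d] by blast
      ultimately show ?thesis using m [rule_format, OF d] by blast
    qed
    then have "\<forall>d. \<exists>f. d < n \<longrightarrow> f \<in> dyads K \<and> u d = w d \<circ> f" by blast
    then obtain f where f: "\<And>d. d < n \<Longrightarrow> f d \<in> dyads K \<and> u d = w d \<circ> f d"
      unfolding choice_iff by blast
    then have "e = p \<circ> box n f"
      unfolding u(1) w(1) box_comp by (intro box_cong) blast
    then show ?thesis using f by (blast intro: boxesI)
  qed simp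
  then show "\<exists>M. \<forall>K. \<forall>e\<in>boxes n (M + K).
      e ` unit_cube n \<inter> p ` unit_cube n = {} \<or> (\<exists>f\<in>boxes n K. e = p \<circ> f)"
    by blast
qed

interpretation unit_cube: cell_system "unit_cube n" "boxes n" for n
  by (rule cell_system_unit_cube)

section \<open>Cellwise bijections belong to the Thompson group\<close>

lemma rectangle_box_image:
  assumes "e \<in> boxes n 0"
  shows "rectangle n (e ` unit_cube n)"
proof -
  obtain u where u: "e = box n u" "\<forall>d<n. u d \<in> dyads 0"
    using assms by (auto simp: boxes_def)
  have "e ` unit_cube n = (\<Pi>\<^sub>E d\<in>{..<n}. u d ` {0..<1})"
  proof (intro Set.set_eqI iffI)
    fix y
    assume y: "y \<in> (\<Pi>\<^sub>E d\<in>{..<n}. u d ` {0..<1})"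
    then obtain t where t: "\<And>d. d < n \<Longrightarrow> t d \<in> {0..<1} \<and> y d = u d (t d)"
      unfolding PiE_iff image_iff by (metis lessThan_iff)
    then have "y = e (restrict t {..<n})"
      using y by (auto simp: u(1) box_def fun_eq_iff PiE_iff extensional_def)
    moreover have "restrict t {..<n} \<in> unit_cube n"
      using t by (auto simp: unit_cube_def)
    ultimately show "y \<in> e ` unit_cube n" by blast
  next
    fix y
    assume "y \<in> e ` unit_cube n"
    then obtain x where x: "x \<in> unit_cube n" "y = box n u x" using u(1) by blast
    show "y \<in> (\<Pi>\<^sub>E d\<in>{..<n}. u d ` {0..<1})"
    proof (rule PiE_I)
      show "y d \<in> u d ` {0..<1}" if "d \<in> {..<n}" for d
        using that unit_cube_apply [OF x(1)] by (auto simp: x(2) simp del: atLeastLessThan_iff)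
    qed (simp add: x(2) box_def)
  qed
  moreover have "dyadic_interval (u d ` {0..<1})" if "d < n" for d
  proof -
    obtain k a where "u d = dyad k a" "a < 2 ^ k"
      using u(2) \<open>d < n\<close> by (auto simp: dyads_def)
    then show ?thesis unfolding dyadic_interval_def by (metis dyad_image)
  qed
  ultimately show ?thesis
    unfolding rectangle_def by (intro exI [of _ "\<lambda>d. u d ` {0..<1}"]) simp
qed

lemma increasing_affine_onto_boxes:
  assumes "e \<in> boxes n 0" "e' \<in> boxes n 0" "\<And>x. x \<in> unit_cube n \<Longrightarrow> f (e x) = e' x"
  shows "increasing_affine_onto n (e ` unit_cube n) (e' ` unit_cube n) f"
proof -
  have *: "\<exists>u k a. w = box n u \<and> (\<forall>d<n. u d = dyad (k d) (a d))" if "w \<in> boxes n 0" for w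
    using that unfolding boxes_def dyads_def mem_Collect_eq by metis
  obtain u k a where u: "e = box n u" "\<forall>d<n. u d = dyad (k d) (a d)"
    using * [OF assms(1)] by blast
  obtain v l b where v: "e' = box n v" "\<forall>d<n. v d = dyad (l d) (b d)"
    using * [OF assms(2)] by blast
  \<comment> \<open>On this cell \<open>f\<close> is \<open>e'\<close> after the inverse of
    \<open>e\<close>: substituting \<open>x d = 2 ^ k d * e x d - a d\<close> into \<open>e'\<close>
    yields the slope and the constant.\<close>
  have "f (e x) d = (2 ^ k d / 2 ^ l d) * e x d + (real (b d) - real (a d)) / 2 ^ l d"
    if "x \<in> unit_cube n" "d < n" for x d
    using that assms(3) u v by (simp add: dyad_def field_simps)
  moreover have "f ` e ` unit_cube n = e' ` unit_cube n"
    using assms(3) by (force simp: image_iff)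
  ultimately show ?thesis
    unfolding increasing_affine_onto_def
    by (intro conjI exI [of _ "\<lambda>d. 2 ^ k d / 2 ^ l d"]
        exI [of _ "\<lambda>d. (real (b d) - real (a d)) / 2 ^ l d"]) auto
qed

text \<open>Nonemptiness makes the numbering injective: equal nonempty members intersect, hence have
  the same index.\<close>

lemma numbered_patternI:
  assumes "\<And>i. i < r \<Longrightarrow> rectangle n (P i)" "\<And>i. i < r \<Longrightarrow> P i \<noteq> {}"
    and "\<And>i j. i < r \<Longrightarrow> j < r \<Longrightarrow> P i \<inter> P j \<noteq> {} \<Longrightarrow> i = j"
    and "(\<Union>i<r. P i) = unit_cube n"
  shows "numbered_pattern n r P"
proof -
  have "inj_on P {..<r}"
    using assms(2,3) by (intro inj_onI) (metis inf.idem lessThan_iff)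
  moreover have "pairwise disjnt (P ` {..<r})"
    using assms(3) by (fastforce simp: pairwise_def disjnt_def)
  ultimately show ?thesis
    using assms(1,4) by (auto simp: numbered_pattern_def is_pattern_def)
qed

text \<open>The grid of cubes of side \<open>2 ^ (- K)\<close> is a pattern, and \<open>f\<close>
  maps each of its cubes canonically onto a rectangle. As \<open>f\<close> is a bijection, these
  rectangles form a pattern as well.\<close>

lemma cellwise_in_thompson_group:
  assumes f: "f \<in> Bij (unit_cube n)" and "cell_system.cellwise (unit_cube n) (boxes n) f"
  shows "f \<in> carrier (thompson_group n)"
proof -
  let ?X = "unit_cube n"
  obtain K where "\<forall>e\<in>boxes n K. \<exists>e'\<in>boxes n 0. \<forall>x\<in>?X. f (e x) = e' x"
    using assms(2) by (auto simp: unit_cube.cellwise_def)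
  then obtain c where c: "\<And>e. e \<in> boxes n K \<Longrightarrow> c e \<in> boxes n 0"
      "\<And>e x. e \<in> boxes n K \<Longrightarrow> x \<in> ?X \<Longrightarrow> f (e x) = c e x"
    by metis
  \<comment> \<open>The positions of the grid cubes; an enumeration of \<open>S\<close> numbers the
    pattern.\<close>
  define S where "S = ({..<n} \<rightarrow>\<^sub>E {..<2 ^ K :: nat})"
  have "finite S" unfolding S_def by (intro finite_PiE) auto
  then obtain a where "bij_betw a {0..<card S} S"
    using ex_bij_betw_nat_finite by blast
  then obtain r where a: "bij_betw a {..<r} S"
    unfolding atLeast0LessThan by blast
  define e where "e i = box n (\<lambda>d. dyad K (a i d))" for i
  define P where "P i = e i ` ?X" for i
  have aS: "a i d < 2 ^ K" if "i < r" "d < n" for i d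
    using a that by (auto simp: bij_betw_def S_def)
  have e: "e i \<in> boxes n K" "e i \<in> boxes n 0" if "i < r" for i
    unfolding e_def using aS that by (auto intro!: boxesI dyadsI)
  have ne: "?X \<noteq> {}" by (auto simp: unit_cube_def PiE_eq_empty_iff)
  have disj: "i = j" if "i < r" "j < r" "P i \<inter> P j \<noteq> {}" for i j
  proof -
    obtain x y where xy: "x \<in> ?X" "y \<in> ?X" "e i x = e j y"
      using \<open>P i \<inter> P j \<noteq> {}\<close> by (auto simp: P_def)
    have "a i d = a j d" if d: "d < n" for d
    proof -
      have "dyad K (a i d) (x d) = dyad K (a j d) (y d)"
        using fun_cong [OF xy(3), of d] d by (simp add: e_def)
      then show ?thesis
        using unit_cube_apply [OF xy(1) d] unit_cube_apply [OF xy(2) d] by (simp add: dyad_eq_iff)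
    qed
    moreover have "a i \<in> S" "a j \<in> S"
      using a that by (auto simp: bij_betw_def)
    ultimately have "a i = a j"
      unfolding S_def by (intro PiE_ext) auto
    then show ?thesis using a that by (auto simp: bij_betw_def inj_on_def)
  qed
  have cover: "(\<Union>i<r. P i) = ?X"
  proof (intro equalityI subsetI)
    fix x
    assume x: "x \<in> ?X"
    \<comment> \<open>Rounding \<open>x\<close> down to the grid finds its cube; the fractional
      parts, collected in \<open>y\<close> below, give the parameter of \<open>x\<close> within that
      cube.\<close>
    define g where "g = (\<lambda>d\<in>{..<n}. nat \<lfloor>x d * 2 ^ K\<rfloor>)"
    have g: "real (g d) = real_of_int \<lfloor>x d * 2 ^ K\<rfloor>" "g d < 2 ^ K" if "d < n" for d
    proof -
      have "0 \<le> x d" "x d < 1" using unit_cube_apply [OF x that] by auto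
      then show "real (g d) = real_of_int \<lfloor>x d * 2 ^ K\<rfloor>" using that by (simp add: g_def)
      also have "\<dots> \<le> x d * 2 ^ K" by linarith
      also have "\<dots> < 2 ^ K" using \<open>x d < 1\<close> by simp
      finally show "g d < 2 ^ K"
        by (metis of_nat_less_iff of_nat_numeral of_nat_power)
    qed
    then have "g \<in> S" by (auto simp: S_def g_def)
    then obtain i where i: "i < r" "a i = g"
      using a by (auto simp: bij_betw_def image_iff)
    define y where "y = (\<lambda>d\<in>{..<n}. x d * 2 ^ K - real (g d))"
    have "y \<in> ?X" using g by (auto simp: y_def unit_cube_def) linarith+
    moreover have "x = e i y"
      using x i by (auto simp: y_def e_def box_def dyad_def fun_eq_iff unit_cube_def PiE_iff extensional_def)
    ultimately have "x \<in> P i" unfolding P_def by blast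
    with i show "x \<in> (\<Union>i<r. P i)" by blast
  next
    fix x
    assume "x \<in> (\<Union>i<r. P i)"
    then obtain i y where "i < r" "y \<in> ?X" "x = e i y" by (auto simp: P_def)
    then show "x \<in> ?X" using unit_cube.cell_closed e(2) by blast
  qed
  have inj: "inj_on f ?X" "f ` ?X = ?X"
    using f by (auto simp: Bij_def bij_betw_def)
  have sub: "P i \<subseteq> ?X" if "i < r" for i using cover that by blast
  have Q: "f ` P i = c (e i) ` ?X" if "i < r" for i
    using c(2) e that by (force simp: P_def image_iff)
  have "numbered_pattern n r P"
    by (rule numbered_patternI) (use disj cover ne e rectangle_box_image in \<open>auto simp: P_def\<close>)
  moreover have "numbered_pattern n r (\<lambda>i. f ` P i)"
  proof (rule numbered_patternI)
    show "rectangle n (f ` P i)" if "i < r" for i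
      using Q e c(1) rectangle_box_image that by metis
    show "i = j" if "i < r" "j < r" "f ` P i \<inter> f ` P j \<noteq> {}" for i j
      using that disj inj_on_image_Int [OF inj(1) sub sub] by (metis image_is_empty)
    show "(\<Union>i<r. f ` P i) = ?X"
      using cover inj(2) by (simp flip: image_UN)
  qed (use ne in \<open>auto simp: P_def\<close>)
  moreover have "increasing_affine_onto n (P i) (f ` P i) f" if "i < r" for i
    unfolding Q [OF that] unfolding P_def
    using increasing_affine_onto_boxes e c that by blast
  ultimately have "\<exists>r P Q. numbered_pattern n r P \<and> numbered_pattern n r Q \<and> is_pattern_map n r P Q f"
    using f unfolding is_pattern_map_def
    by (intro exI [of _ r] exI [of _ P] exI [of _ "\<lambda>i. f ` P i"]) simp
  then show ?thesis by (simp add: thompson_group_def)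
qed

section \<open>The embedding\<close>

text \<open>Unlike \<open>box n F\<close>, this is restricted to the cube, as members of
  \<open>Bij (unit_cube n)\<close> must be.\<close>

definition product_map :: "nat \<Rightarrow> (nat \<Rightarrow> real \<Rightarrow> real) \<Rightarrow> (nat \<Rightarrow> real) \<Rightarrow> nat \<Rightarrow> real" where
  "product_map n F = (\<lambda>x\<in>unit_cube n. box n F x)"

lemma product_map_Bij:
  assumes F: "\<And>d. d < n \<Longrightarrow> F d \<in> Bij {0..<1}"
  shows "product_map n F \<in> Bij (unit_cube n)"
proof -
  have bij: "bij_betw (F d) {0..<1} {0..<1}" if "d < n" for d
    using F that by (auto simp: Bij_def)
  have "bij_betw (product_map n F) (unit_cube n) (unit_cube n)"
  proof (rule bij_betw_byWitness [where f' = "box n (\<lambda>d. inv_into {0..<1} (F d))"])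
    show "\<forall>x\<in>unit_cube n. box n (\<lambda>d. inv_into {0..<1} (F d)) (product_map n F x) = x"
    proof
      fix x
      assume x: "x \<in> unit_cube n"
      have "inv_into {0..<1} (F d) (F d (x d)) = x d" if "d < n" for d
        using bij_betw_inv_into_left [OF bij [OF that]] unit_cube_apply [OF x that] by blast
      then show "box n (\<lambda>d. inv_into {0..<1} (F d)) (product_map n F x) = x"
        using x by (auto simp: product_map_def box_def fun_eq_iff unit_cube_def PiE_iff extensional_def)
    qed
    show *: "box n (\<lambda>d. inv_into {0..<1} (F d)) ` unit_cube n \<subseteq> unit_cube n"
      using bij_betw_apply [OF bij_betw_inv_into [OF bij]] unit_cube_apply
      by (blast intro: box_unit_cube)
    show "product_map n F ` unit_cube n \<subseteq> unit_cube n"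
      using bij_betw_apply [OF bij] unit_cube_apply
      by (auto simp: product_map_def simp del: atLeastLessThan_iff intro!: box_unit_cube)
    show "\<forall>y\<in>unit_cube n. product_map n F (box n (\<lambda>d. inv_into {0..<1} (F d)) y) = y"
    proof
      fix y
      assume y: "y \<in> unit_cube n"
      have "F d (inv_into {0..<1} (F d) (y d)) = y d" if "d < n" for d
        using bij_betw_inv_into_right [OF bij [OF that]] unit_cube_apply [OF y that] by blast
      moreover have "box n (\<lambda>d. inv_into {0..<1} (F d)) y \<in> unit_cube n"
        using y * by blast
      ultimately show "product_map n F (box n (\<lambda>d. inv_into {0..<1} (F d)) y) = y"
        using y by (auto simp: product_map_def box_def fun_eq_iff unit_cube_def PiE_iff extensional_def)
    qed
  qed
  then show ?thesis by (simp add: Bij_def product_map_def)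
qed

lemma compose_product_map:
  assumes "\<And>d. d < n \<Longrightarrow> G d \<in> Bij {0..<1}"
  shows "compose (unit_cube n) (product_map n F) (product_map n G)
    = product_map n (\<lambda>d. compose {0..<1} (F d) (G d))"
proof
  fix x
  show "compose (unit_cube n) (product_map n F) (product_map n G) x
    = product_map n (\<lambda>d. compose {0..<1} (F d) (G d)) x"
  proof (cases "x \<in> unit_cube n")
    case True
    then have "product_map n G x \<in> unit_cube n"
      using Bij_imp_funcset [OF product_map_Bij [of n G]] assms by blast
    with True show ?thesis
      using unit_cube_apply [OF True] by (auto simp: compose_def product_map_def box_def)
  qed (simp add: compose_def product_map_def)
qed

text \<open>There are finitely many coordinates, so one level \<open>K\<close> is fine enough for
  all the maps \<open>F d\<close> at once.\<close>

lemma cellwise_product_map: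
  assumes "\<And>d. d < n \<Longrightarrow> unit_interval.cellwise (F d)"
  shows "cell_system.cellwise (unit_cube n) (boxes n) (product_map n F)"
proof -
  obtain k where k: "\<And>d e. d < n \<Longrightarrow> e \<in> dyads (k d) \<Longrightarrow>
      \<exists>e'\<in>dyads 0. \<forall>t\<in>{0..<1}. F d (e t) = e' t"
    using assms unfolding unit_interval.cellwise_def by metis
  define K where "K = (\<Sum>d<n. k d)"
  have "\<exists>e'\<in>boxes n 0. \<forall>x\<in>unit_cube n. product_map n F (e x) = e' x" if e: "e \<in> boxes n K" for e
  proof -
    obtain u where u: "e = box n u" "\<And>d. d < n \<Longrightarrow> u d \<in> dyads K"
      using e by (auto simp: boxes_def)
    have "\<exists>v\<in>dyads 0. \<forall>t\<in>{0..<1}. F d (u d t) = v t" if d: "d < n" for d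
    proof -
      have "k d \<le> K" unfolding K_def using d by (intro member_le_sum) auto
      then show ?thesis
        using k [OF d] u(2) [OF d] unit_interval.level_mono by blast
    qed
    then obtain v where v: "\<And>d. d < n \<Longrightarrow> v d \<in> dyads 0 \<and> (\<forall>t\<in>{0..<1}. F d (u d t) = v d t)"
      by metis
    have "product_map n F (e x) = box n v x" if "x \<in> unit_cube n" for x
      using unit_cube.cell_closed [OF e that] v unit_cube_apply [OF that] u(1)
      by (auto simp: product_map_def box_def simp del: atLeastLessThan_iff)
    then show ?thesis using v by (blast intro: boxesI)
  qed
  then show ?thesis unfolding unit_cube.cellwise_def by blast
qed

text \<open>Powers of the single map \<open>g\<close> compose by adding exponents, and the
  coordinates do not interact.\<close>

lemma product_pow_hom:
  assumes "g \<in> Bij {0..<1}"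
  shows "(\<lambda>k :: nat \<Rightarrow> int. product_map n (\<lambda>d. g [^]\<^bsub>BijGroup {0..<1}\<^esub> k d))
    \<in> hom (product_group {..<n} (\<lambda>_. integer_group)) (BijGroup (unit_cube n))"
proof -
  interpret group "BijGroup {0..<1::real}" by (rule group_BijGroup)
  have pow: "g [^]\<^bsub>BijGroup {0..<1}\<^esub> z \<in> Bij {0..<1}" for z :: int
    using assms int_pow_closed by (simp add: carrier_BijGroup)
  have add: "compose {0..<1} (g [^]\<^bsub>BijGroup {0..<1}\<^esub> y) (g [^]\<^bsub>BijGroup {0..<1}\<^esub> z)
      = g [^]\<^bsub>BijGroup {0..<1}\<^esub> (y + z)" for y z :: int
    using assms int_pow_mult [of g y z] mult_BijGroup [OF pow pow] by (simp add: carrier_BijGroup)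
  show ?thesis
  proof (rule homI)
    fix k l
    \<comment> \<open>The product of \<open>k\<close> and \<open>l\<close> is
      \<open>k d + l d\<close> for \<open>d < n\<close> but \<open>undefined\<close> beyond, so the
      maps are compared through coordinates below \<open>n\<close>.\<close>
    have "product_map n (\<lambda>d. g [^]\<^bsub>BijGroup {0..<1}\<^esub> (k \<otimes>\<^bsub>product_group {..<n} (\<lambda>_. integer_group)\<^esub> l) d)
        = product_map n (\<lambda>d. g [^]\<^bsub>BijGroup {0..<1}\<^esub> (k d + l d))"
      unfolding product_map_def by (intro restrict_ext box_cong [THEN fun_cong]) simp
    then show "product_map n (\<lambda>d. g [^]\<^bsub>BijGroup {0..<1}\<^esub> (k \<otimes>\<^bsub>product_group {..<n} (\<lambda>_. integer_group)\<^esub> l) d)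
        = product_map n (\<lambda>d. g [^]\<^bsub>BijGroup {0..<1}\<^esub> k d) \<otimes>\<^bsub>BijGroup (unit_cube n)\<^esub>
          product_map n (\<lambda>d. g [^]\<^bsub>BijGroup {0..<1}\<^esub> l d)"
      by (simp add: mult_BijGroup product_map_Bij pow compose_product_map add)
  qed (simp add: carrier_BijGroup product_map_Bij pow)
qed

theorem mainTheorem3:
  fixes n :: nat
  assumes "n \<ge> 1"
  shows "\<exists>h \<in> hom (free_product (product_group {..<n} (\<lambda>_. integer_group)) integer_group)
                   (thompson_group n).
           inj_on h (carrier (free_product (product_group {..<n} (\<lambda>_. integer_group)) integer_group))"
proof -
  let ?I = "{0..<1::real}" and ?X = "unit_cube n"
  let ?Zn = "product_group {..<n} (\<lambda>_. integer_group)" and ?B = "BijGroup (unit_cube n)"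
  interpret B: group ?B by (rule group_BijGroup)
  define g where "g = exchange ?I (dyad 2 2) (dyad 2 3)"
  \<comment> \<open>The two cubes are \<open>[0, 1/8)^n\<close> and \<open>[1/8, 1/4)^n\<close>.
    Level 3 leaves room in \<open>S\<close> for a base point outside both; level 2 would leave none
    when \<open>n = 1\<close>.\<close>
  define p where "p = box n (\<lambda>_. dyad 3 0)"
  define q where "q = box n (\<lambda>_. dyad 3 1)"
  define b where "b = exchange ?X p q"
  define \<phi> where "\<phi> = (\<lambda>k :: nat \<Rightarrow> int. product_map n (\<lambda>d. g [^]\<^bsub>BijGroup ?I\<^esub> k d))"
  define \<psi> where "\<psi> = (\<lambda>z :: int. b [^]\<^bsub>?B\<^esub> z)"
  \<comment> \<open>\<open>N\<close> is closed under products, contains the images of both factors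
    and lies in the Thompson group.\<close>
  define N where "N = {f \<in> Bij ?X. cell_system.cellwise ?X (boxes n) f}"
  define S where "S = {x \<in> ?X. \<forall>d<n. x d < 1 / 2}"
  \<comment> \<open>Half-openness matters: \<open>1/4\<close> is the excluded right end of the
    second small cube in each coordinate, and it is below \<open>1/2\<close>.\<close>
  define x0 where "x0 = (\<lambda>d\<in>{..<n}. 1 / 4 :: real)"

  have dyads: "dyad 2 2 \<in> dyads 0" "dyad 2 3 \<in> dyads 0" "dyad 3 0 \<in> dyads 0" "dyad 3 1 \<in> dyads 0"
    by (fastforce simp: dyads_def)+
  note gI = unit_interval.maps [OF dyads(1)] unit_interval.maps [OF dyads(2)]
    unit_interval.inj [OF dyads(1)] unit_interval.inj [OF dyads(2)]
  have pq: "p \<in> boxes n 0" "q \<in> boxes n 0"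
    using dyads by (auto simp: p_def q_def intro: boxesI)
  note bI = unit_cube.maps [OF pq(1)] unit_cube.maps [OF pq(2)]
    unit_cube.inj [OF pq(1)] unit_cube.inj [OF pq(2)]
  have gB: "g \<in> Bij ?I" unfolding g_def by (rule exchange_Bij [OF gI])
  have bB: "b \<in> carrier ?B" unfolding b_def carrier_BijGroup by (rule exchange_Bij [OF bI])
  have \<phi>: "\<phi> \<in> hom ?Zn ?B" unfolding \<phi>_def by (rule product_pow_hom [OF gB])
  have \<psi>: "\<psi> \<in> hom integer_group ?B" unfolding \<psi>_def by (rule B.hom_integer_group_pow [OF bB])

  \<comment> \<open>The ping-pong dynamics\<close>
  have small: "y d < 1 / 4" if "y \<in> p ` ?X \<union> q ` ?X" "d < n" for y d
    using that unit_cube_apply by (fastforce simp: p_def q_def dyad_def)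
  have x0: "x0 \<in> ?X" by (auto simp: x0_def unit_cube_def)
  have "x0 0 = 1 / 4" using assms by (simp add: x0_def)
  then have x0_pq: "x0 \<notin> p ` ?X \<union> q ` ?X" using small [of x0 0] assms by auto
  have sub_S: "insert x0 (p ` ?X \<union> q ` ?X) \<subseteq> S"
  proof -
    have "p ` ?X \<union> q ` ?X \<subseteq> ?X" using bI by blast
    moreover have "y d < 1 / 2" if "y \<in> p ` ?X \<union> q ` ?X" "d < n" for y d
      using small [OF that] by simp
    ultimately have "p ` ?X \<union> q ` ?X \<subseteq> S" unfolding S_def by blast
    moreover have "x0 \<in> S" using x0 by (simp add: S_def x0_def)
    ultimately show ?thesis by blast
  qed
  have \<phi>_S: "\<phi> k y \<in> ?X - S" if k: "k \<in> carrier ?Zn" "k \<noteq> \<one>\<^bsub>?Zn\<^esub>" and "y \<in> S" for k y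
  proof -
    \<comment> \<open>One nonzero exponent is enough: in its coordinate the power of
      \<open>g\<close> moves \<open>[0, 1/2)\<close> into \<open>[1/2, 1)\<close>, whereas points of
      \<open>S\<close> have every coordinate below \<open>1/2\<close>.\<close>
    obtain d where d: "d < n" "k d \<noteq> 0"
      using k by (auto simp: PiE_iff extensional_def fun_eq_iff restrict_def split: if_splits)
    have y: "y \<in> ?X" "y d \<in> ?I" "y d < 1 / 2"
      using that(3) d unit_cube_apply by (auto simp: S_def)
    have "(g [^]\<^bsub>BijGroup ?I\<^esub> k d) (y d) \<in> dyad 2 2 ` ?I \<union> dyad 2 3 ` ?I"
      unfolding g_def using y d(2)
      by (intro exchange_int_pow_wandering [OF gI]) (auto simp: dyad_image)
    then have "\<not> \<phi> k y d < 1 / 2"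
      using y d by (auto simp: \<phi>_def product_map_def dyad_image)
    moreover have "\<phi> k \<in> Bij ?X"
      using hom_in_carrier [OF \<phi> k(1)] by (simp only: carrier_BijGroup)
    then have "\<phi> k y \<in> ?X" using y(1) Bij_imp_funcset by blast
    ultimately show ?thesis using d by (auto simp: S_def)
  qed
  have \<psi>_S: "\<psi> z y \<in> p ` ?X \<union> q ` ?X" if "z \<noteq> 0" "y \<in> insert x0 (?X - S)" for z y
  proof -
    have "p ` ?X \<inter> q ` ?X = {}"
    proof -
      \<comment> \<open>Coordinate 0, available since \<open>n \<ge> 1\<close>, separates the cubes:
        its intervals have the same level and different indices 0 and 1.\<close>
      have "p x \<noteq> q y" if "x \<in> ?X" "y \<in> ?X" for x y
      proof
        assume "p x = q y"
        then have "p x 0 = q y 0" by simp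
        then show False
          using assms unit_cube_apply [OF that(1), of 0] unit_cube_apply [OF that(2), of 0]
          by (simp add: p_def q_def dyad_eq_iff)
      qed
      then show ?thesis by blast
    qed
    moreover have "y \<in> ?X" "y \<notin> p ` ?X" "y \<notin> q ` ?X"
      using that(2) x0 x0_pq sub_S by auto
    ultimately show ?thesis
      unfolding \<psi>_def b_def using exchange_int_pow_wandering [OF bI] that(1) by blast
  qed
  have inj: "inj_on (free_lift ?B \<phi> \<psi>) (carrier (free_product ?Zn integer_group))"
  \<comment> \<open>The table has the complement of \<open>S\<close> as target of the first factor
    and the two small cubes, inside \<open>S\<close>, as target of the second; \<open>x0\<close>
    lies in \<open>S\<close> outside these cubes.\<close>
  proof (rule ping_pong [OF _ _ \<phi> \<psi> x0, of "?X - S" "p ` ?X \<union> q ` ?X"])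
    show "x0 \<notin> ?X - S" "x0 \<notin> p ` ?X \<union> q ` ?X" "p ` ?X \<union> q ` ?X \<subseteq> ?X"
      using sub_S x0_pq bI by blast+
    show "\<phi> k y \<in> ?X - S"
      if "k \<in> carrier ?Zn" "k \<noteq> \<one>\<^bsub>?Zn\<^esub>" "y \<in> insert x0 (p ` ?X \<union> q ` ?X)" for k y
      using \<phi>_S that sub_S by blast
    show "\<psi> z y \<in> p ` ?X \<union> q ` ?X"
      if "z \<noteq> \<one>\<^bsub>integer_group\<^esub>" "y \<in> insert x0 (?X - S)" for z y
      using \<psi>_S that by simp
  qed simp_all

  \<comment> \<open>The image lies in the Thompson group\<close>
  have "free_lift ?B \<phi> \<psi> w \<in> N" if "w \<in> reduced_words ?Zn integer_group" for w
  proof (rule free_lift_in [where G = ?Zn and H = integer_group])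
    show "\<one>\<^bsub>?B\<^esub> \<in> N"
      by (simp only: N_def one_BijGroup mem_Collect_eq id_Bij unit_cube.cellwise_id simp_thms)
    show "f \<otimes>\<^bsub>?B\<^esub> f' \<in> N" if "f \<in> N" "f' \<in> N" for f f'
      using that by (auto simp: N_def mult_BijGroup compose_Bij unit_cube.cellwise_compose)
    show "\<phi> ` carrier ?Zn \<subseteq> N"
    proof -
      have "cell_system.cellwise ?X (boxes n) (\<phi> k)" for k
        unfolding \<phi>_def g_def
        by (intro cellwise_product_map unit_interval.cellwise_exchange_int_pow dyads)
      moreover have "\<phi> ` carrier ?Zn \<subseteq> Bij ?X"
        using \<phi> by (auto simp: hom_def carrier_BijGroup)
      ultimately show ?thesis by (auto simp: N_def)
    qed
    show "\<psi> ` carrier integer_group \<subseteq> N"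
    proof -
      have "cell_system.cellwise ?X (boxes n) (\<psi> z)" for z
        unfolding \<psi>_def b_def by (intro unit_cube.cellwise_exchange_int_pow pq)
      moreover have "\<psi> ` carrier integer_group \<subseteq> Bij ?X"
        using \<psi> by (auto simp: hom_def carrier_BijGroup)
      ultimately show ?thesis by (auto simp: N_def)
    qed
    show "set w \<subseteq> letters ?Zn integer_group"
      using that by (rule reduced_words_letters)
  qed
  then have "free_lift ?B \<phi> \<psi> w \<in> carrier (thompson_group n)"
    if "w \<in> reduced_words ?Zn integer_group" for w
    using that cellwise_in_thompson_group by (auto simp: N_def)
  moreover have "free_lift ?B \<phi> \<psi> \<in> hom (free_product ?Zn integer_group) ?B"
    using \<phi> \<psi> group_BijGroup by (intro free_lift_hom) auto
  \<comment> \<open>The Thompson group inherits its multiplication from the group of bijections, so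
    only the codomain has to be narrowed.\<close>
  ultimately have "free_lift ?B \<phi> \<psi> \<in> hom (free_product ?Zn integer_group) (thompson_group n)"
    by (auto simp: hom_def carrier_free_product thompson_group_def)
  with inj show ?thesis by blast
qed

end
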